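(* Let $f:\mathbb{R}\to\{-1,+1\}$ be a (possibly random) label function and $\delta>1$. Let $\sigma_{\rm opt}:=\min\{\sigma\ge0:\kappa(\sigma)=1/\delta\}$, let $W_{\rm opt}:=\sigma_{\rm opt}G+SY$ and let $p_{W_{\rm opt}}$ denote its density. Consider the loss function $\ell_{\rm opt}:\mathbb{R}\to\mathbb{R}$, $$\ell_{\rm opt}(w)=-\mathcal{M}_{\alpha_1q+\alpha_2\log(p_{W_{\rm opt}})}(w;1),$$ where $q(x)=x^2/2$ and $$\alpha_1=\frac{1-\sigma_{\rm opt}^2\mathcal{I}(W_{\rm opt})}{\delta\left(\sigma_{\rm opt}^2\mathcal{I}(W_{\rm opt})+\mathcal{I}(W_{\rm opt})-1\right)},\qquad \alpha_2=\frac{1}{\delta\left(\sigma_{\rm opt}^2\mathcal{I}(W_{\rm opt})+\mathcal{I}(W_{\rm opt})-1\right)}.$$ If $\ell_{\rm opt}$ is convex and the equation $\kappa(\sigma)=1/\delta$ has a unique solution, then $\sigma_{\ell_{\rm opt}}=\sigma_{\rm opt}$.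
   Context: $G,S$ are i.i.d. $\mathcal{N}(0,1)$ and $Y=f(S)$; expectations are over $G,S$ and the possible internal randomness of $f$. For a function $h$ and $\lambda>0$, the Moreau envelope is $\mathcal{M}_h(x;\lambda)=\min_v\frac1{2\lambda}(x-v)^2+h(v)$, and $\mathcal{M}'_{h,1}(x;\lambda)$ is its partial derivative in $x$. For a random variable $H$ with differentiable density $p_H$, $\mathcal{I}(H)=\mathbb{E}[(p_H'(H)/p_H(H))^2]$ is the Fisher information. For $\sigma>0$, $W_\sigma:=\sigma G+SY$ and $$\kappa(\sigma):=\frac{\sigma^2\left(\sigma^2\mathcal{I}(W_\sigma)+\mathcal{I}(W_\sigma)-1\right)}{1+\sigma^2\left(\sigma^2\mathcal{I}(W_\sigma)-1\right)},\qquad\kappa(0):=0.$$ For a convex loss $\ell$, $\sigma_\ell:=\alpha/\mu$, where $(\mu\ne0,\alpha\ge0,\lambda>0)$ is the solution (assumed unique) of the system $$\mathbb{E}[YS\,\mathcal{M}'_{\ell,1}(\alpha G+\mu SY;\lambda)]=0,\quad \lambda^2\delta\,\mathbb{E}[(\mathcal{M}'_{\ell,1}(\alpha G+\mu SY;\lambda))^2]=\alpha^2,\quad \lambda\delta\,\mathbb{E}[G\,\mathcal{M}'_{\ell,1}(\alpha G+\mu SY;\lambda)]=\alpha.$$ *)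

theory Defs
  imports "HOL-Probability.Probability"
begin

definition moreau_objective :: "(real \<Rightarrow> real) \<Rightarrow> real \<Rightarrow> real \<Rightarrow> real \<Rightarrow> real" where
  "moreau_objective h x lam v = 1 / (2 * lam) * (x - v)\<^sup>2 + h v"

text \<open>The Moreau envelope is a minimum, not merely an infimum: its value is meaningful only where
  \<^const>\<open>moreau_objective\<close> attains its minimum in \<open>v\<close>. This is automatic for a convex
  \<open>h :: real \<Rightarrow> real\<close> and \<open>lam > 0\<close>.\<close>

definition moreau_env :: "(real \<Rightarrow> real) \<Rightarrow> real \<Rightarrow> real \<Rightarrow> real" where
  "moreau_env h x lam = (LEAST m. m \<in> range (moreau_objective h x lam))"

definition moreau_deriv :: "(real \<Rightarrow> real) \<Rightarrow> real \<Rightarrow> real \<Rightarrow> real" where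
  "moreau_deriv h x lam = deriv (\<lambda>t. moreau_env h t lam) x"

text \<open>Two differentiable densities of the same law agree almost everywhere and are continuous, hence
  are equal; so the description below is definite whenever a differentiable density exists.\<close>

definition diff_density :: "'w measure \<Rightarrow> ('w \<Rightarrow> real) \<Rightarrow> real \<Rightarrow> real" where
  "diff_density M H = (THE p. (\<forall>x. 0 \<le> p x) \<and> (\<forall>x. p differentiable (at x)) \<and>
      distributed M lborel H (\<lambda>x. ennreal (p x)))"

definition fisher_info :: "'w measure \<Rightarrow> ('w \<Rightarrow> real) \<Rightarrow> real" where
  "fisher_info M H =
     (\<integral>\<omega>. (deriv (diff_density M H) (H \<omega>) / diff_density M H (H \<omega>))\<^sup>2 \<partial>M)"

text \<open>The Fisher information of \<open>W_rv G S Y \<sigma>\<close> is finite for \<open>\<sigma> > 0\<close> (at most \<open>1 / \<sigma>\<^sup>2\<close>), so the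
  convention that non-integrable functions have integral 0 plays no role in \<open>kappa\<close>.\<close>

definition W_rv :: "('w \<Rightarrow> real) \<Rightarrow> ('w \<Rightarrow> real) \<Rightarrow> ('w \<Rightarrow> real) \<Rightarrow> real \<Rightarrow> 'w \<Rightarrow> real" where
  "W_rv G S Y \<sigma> = (\<lambda>\<omega>. \<sigma> * G \<omega> + S \<omega> * Y \<omega>)"

definition kappa ::
  "'w measure \<Rightarrow> ('w \<Rightarrow> real) \<Rightarrow> ('w \<Rightarrow> real) \<Rightarrow> ('w \<Rightarrow> real) \<Rightarrow> real \<Rightarrow> real" where
  "kappa M G S Y \<sigma> = (if \<sigma> = 0 then 0 else
     (let I = fisher_info M (W_rv G S Y \<sigma>)
      in \<sigma>\<^sup>2 * (\<sigma>\<^sup>2 * I + I - 1) / (1 + \<sigma>\<^sup>2 * (\<sigma>\<^sup>2 * I - 1))))"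

definition sigma_opt ::
  "'w measure \<Rightarrow> ('w \<Rightarrow> real) \<Rightarrow> ('w \<Rightarrow> real) \<Rightarrow> ('w \<Rightarrow> real) \<Rightarrow> real \<Rightarrow> real" where
  "sigma_opt M G S Y \<delta> = (LEAST \<sigma>. 0 \<le> \<sigma> \<and> kappa M G S Y \<sigma> = 1 / \<delta>)"

definition W_opt ::
  "'w measure \<Rightarrow> ('w \<Rightarrow> real) \<Rightarrow> ('w \<Rightarrow> real) \<Rightarrow> ('w \<Rightarrow> real) \<Rightarrow> real \<Rightarrow> 'w \<Rightarrow> real" where
  "W_opt M G S Y \<delta> = W_rv G S Y (sigma_opt M G S Y \<delta>)"

definition alpha1 ::
  "'w measure \<Rightarrow> ('w \<Rightarrow> real) \<Rightarrow> ('w \<Rightarrow> real) \<Rightarrow> ('w \<Rightarrow> real) \<Rightarrow> real \<Rightarrow> real" where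
  "alpha1 M G S Y \<delta> =
     (let s = sigma_opt M G S Y \<delta>; I = fisher_info M (W_opt M G S Y \<delta>)
      in (1 - s\<^sup>2 * I) / (\<delta> * (s\<^sup>2 * I + I - 1)))"

definition alpha2 ::
  "'w measure \<Rightarrow> ('w \<Rightarrow> real) \<Rightarrow> ('w \<Rightarrow> real) \<Rightarrow> ('w \<Rightarrow> real) \<Rightarrow> real \<Rightarrow> real" where
  "alpha2 M G S Y \<delta> =
     (let s = sigma_opt M G S Y \<delta>; I = fisher_info M (W_opt M G S Y \<delta>)
      in 1 / (\<delta> * (s\<^sup>2 * I + I - 1)))"

definition h_opt ::
  "'w measure \<Rightarrow> ('w \<Rightarrow> real) \<Rightarrow> ('w \<Rightarrow> real) \<Rightarrow> ('w \<Rightarrow> real) \<Rightarrow> real \<Rightarrow> real \<Rightarrow> real" where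
  "h_opt M G S Y \<delta> x = alpha1 M G S Y \<delta> * (x\<^sup>2 / 2) +
     alpha2 M G S Y \<delta> * ln (diff_density M (W_opt M G S Y \<delta>) x)"

definition l_opt ::
  "'w measure \<Rightarrow> ('w \<Rightarrow> real) \<Rightarrow> ('w \<Rightarrow> real) \<Rightarrow> ('w \<Rightarrow> real) \<Rightarrow> real \<Rightarrow> real \<Rightarrow> real" where
  "l_opt M G S Y \<delta> w = - moreau_env (h_opt M G S Y \<delta>) w 1"

text \<open>For a convex \<open>l\<close> the map \<open>x \<mapsto> moreau_deriv l x lam\<close> is Lipschitz, so all three expectations
  below exist.\<close>

definition solves_system ::
  "'w measure \<Rightarrow> ('w \<Rightarrow> real) \<Rightarrow> ('w \<Rightarrow> real) \<Rightarrow> ('w \<Rightarrow> real) \<Rightarrow> real \<Rightarrow> (real \<Rightarrow> real) \<Rightarrow>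
   real \<times> real \<times> real \<Rightarrow> bool" where
  "solves_system M G S Y \<delta> l = (\<lambda>(\<mu>, \<alpha>, lam).
     \<mu> \<noteq> 0 \<and> 0 \<le> \<alpha> \<and> 0 < lam \<and>
     (\<integral>\<omega>. Y \<omega> * S \<omega> * moreau_deriv l (\<alpha> * G \<omega> + \<mu> * S \<omega> * Y \<omega>) lam \<partial>M) = 0 \<and>
     lam\<^sup>2 * \<delta> * (\<integral>\<omega>. (moreau_deriv l (\<alpha> * G \<omega> + \<mu> * S \<omega> * Y \<omega>) lam)\<^sup>2 \<partial>M) = \<alpha>\<^sup>2 \<and>
     lam * \<delta> * (\<integral>\<omega>. G \<omega> * moreau_deriv l (\<alpha> * G \<omega> + \<mu> * S \<omega> * Y \<omega>) lam \<partial>M) = \<alpha>)"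

definition sigma_loss ::
  "'w measure \<Rightarrow> ('w \<Rightarrow> real) \<Rightarrow> ('w \<Rightarrow> real) \<Rightarrow> ('w \<Rightarrow> real) \<Rightarrow> real \<Rightarrow> (real \<Rightarrow> real) \<Rightarrow> real" where
  "sigma_loss M G S Y \<delta> l =
     (case (THE t. solves_system M G S Y \<delta> l t) of (\<mu>, \<alpha>, lam) \<Rightarrow> \<alpha> / \<mu>)"

text \<open>A label function \<open>f\<close> with internal randomness: \<open>Y = f(S)\<close> is \<open>f (S \<omega>) (U \<omega>)\<close>, where the seed
  \<open>U\<close>, with values in an arbitrary measurable space \<open>N\<close>, is independent of \<open>(G, S)\<close> (stated for the preimage
  families, as \<^const>\<open>prob_space.indep_var\<close> needs both variables to have the same type). A deterministic
  label function is one that ignores its second argument.\<close>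

definition label_model ::
  "'w measure \<Rightarrow> ('w \<Rightarrow> real) \<Rightarrow> ('w \<Rightarrow> real) \<Rightarrow> 'u measure \<Rightarrow> ('w \<Rightarrow> 'u) \<Rightarrow>
   (real \<Rightarrow> 'u \<Rightarrow> real) \<Rightarrow> ('w \<Rightarrow> real) \<Rightarrow> bool" where
  "label_model M G S N U f Y \<longleftrightarrow>
     prob_space M \<and>
     distributed M lborel G (\<lambda>x. ennreal (std_normal_density x)) \<and>
     distributed M lborel S (\<lambda>x. ennreal (std_normal_density x)) \<and>
     prob_space.indep_var M borel G borel S \<and>
     U \<in> M \<rightarrow>\<^sub>M N \<and>
     prob_space.indep_set M
       {(\<lambda>\<omega>. (G \<omega>, S \<omega>)) -` A \<inter> space M |A. A \<in> sets (borel \<Otimes>\<^sub>M borel)}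
       {U -` B \<inter> space M |B. B \<in> sets N} \<and>
     (\<lambda>(s, u). f s u) \<in> borel_measurable (borel \<Otimes>\<^sub>M N) \<and>
     (\<forall>s. \<forall>u\<in>space N. f s u \<in> {-1, 1}) \<and>
     (\<forall>\<omega>\<in>space M. Y \<omega> = f (S \<omega>) (U \<omega>))"

end

theory Submission
  imports Defs
begin

text \<open>Write \<open>Z = S Y\<close>, \<open>\<sigma>\<close> for the optimal noise level, \<open>W = \<sigma> G + Z\<close>, \<open>p\<close> for the density of
  \<open>W\<close>, \<open>\<xi> = p' / p\<close> for its score and \<open>I = E[\<xi>(W)\<^sup>2]\<close> for its Fisher information. The triple
  \<open>(\<mu>, \<alpha>, \<lambda>) = (1, \<sigma>, 1)\<close> solves the system of the optimal loss; since the system has at most one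
  solution, the ratio \<open>\<alpha> / \<mu>\<close> of its solution is \<open>\<sigma>\<close>. At this triple the argument
  \<open>\<alpha> G + \<mu> S Y\<close> is \<open>W\<close> itself, and two facts make the three expectations computable.

  The loss was built to have a known envelope. It is \<open>- M\<^sub>h\<close> with \<open>h = \<alpha>\<^sub>1 q + \<alpha>\<^sub>2 ln p\<close>, and
  \<open>q - M\<^sub>h\<close> is the Legendre conjugate of \<open>q + h\<close>; conjugating twice returns \<open>q + h\<close>, so that the
  envelope of the loss is \<open>- h\<close>, as soon as \<open>q + h\<close> has a support line at every point (\<open>moreau_env_neg_moreau_env\<close>). The
  equation \<open>\<kappa>(\<sigma>) = 1 / \<delta>\<close> says exactly \<open>1 + \<alpha>\<^sub>1 = \<alpha>\<^sub>2 / \<sigma>\<^sup>2\<close>, so that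
  \<open>q + h = \<alpha>\<^sub>2 (ln p(x) + x\<^sup>2 / (2 \<sigma>\<^sup>2))\<close>. Completing the square in the Gaussian kernel shows that
  the bracket is, up to a constant, the logarithm of a moment generating function, which has support lines by
  Jensen's inequality (\<open>ln_dens_support_line\<close>); and \<open>\<alpha>\<^sub>2 > 0\<close> by the Cramer-Rao inequality
  \<open>(1 + \<sigma>\<^sup>2) I \<ge> 1\<close> (\<open>cramer_rao\<close>). Hence the derivative of the envelope of the loss is the score
  combination \<open>- (\<alpha>\<^sub>1 x + \<alpha>\<^sub>2 \<xi>(x))\<close> (\<open>moreau_deriv_score_loss\<close>).

  Its moments against \<open>G\<close>, \<open>Z\<close> and itself follow from Tweedie's identity
  \<open>\<sigma> E[g(W) \<xi>(W)] = - E[G g(W)]\<close> (\<open>tweedie\<close>), which expresses that \<open>\<xi>(W)\<close> is the conditional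
  expectation of \<open>- G / \<sigma>\<close> given \<open>W\<close>. They are polynomials in \<open>\<alpha>\<^sub>1\<close>, \<open>\<alpha>\<^sub>2\<close>, \<open>\<sigma>\<close> and \<open>I\<close>
  (\<open>second_moments\<close>). The first and third equations then hold by the choice of \<open>\<alpha>\<^sub>1\<close> and
  \<open>\<alpha>\<^sub>2\<close>; the second one is again the equation for \<open>\<kappa>\<close>, because the polynomial is
  \<open>\<alpha>\<^sub>2\<^sup>2\<close> times the product of the two expressions whose quotient is \<open>\<kappa> / \<sigma>\<^sup>2\<close> (\<open>optimal_coefficients\<close>).\<close>

section \<open>Moreau envelopes\<close>

lemma moreau_env_eq_minimum:
  assumes "\<And>v. moreau_objective h x lam v\<^sub>0 \<le> moreau_objective h x lam v"
  shows "moreau_env h x lam = moreau_objective h x lam v\<^sub>0"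
  unfolding moreau_env_def using assms by (intro Least_equality) auto

text \<open>With \<open>F = h + q\<close>, the function \<open>q - M\<^sub>h\<close> is the Legendre conjugate of \<open>F\<close>, and the envelope of
  \<open>- M\<^sub>h\<close> is \<open>q\<close> minus the biconjugate of \<open>F\<close>. The biconjugate agrees with \<open>F\<close> wherever \<open>F\<close> has a
  support line, and the outer minimum is then attained at the slope of that line.\<close>

lemma moreau_env_neg_moreau_env:
  assumes attained: "\<And>w. \<exists>v\<^sub>0. \<forall>v. moreau_objective h w 1 v\<^sub>0 \<le> moreau_objective h w 1 v"
    and support: "\<And>v. h x + x\<^sup>2 / 2 + c * (v - x) \<le> h v + v\<^sup>2 / 2"
  shows "moreau_env (\<lambda>w. - moreau_env h w 1) x 1 = - h x"
proof -
  have env_le: "moreau_env h w 1 \<le> moreau_objective h w 1 v" for w v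
    using attained[of w] moreau_env_eq_minimum[of h w 1] by metis
  have "moreau_objective h c 1 x \<le> moreau_objective h c 1 v" for v
    using support[of v] by (simp add: moreau_objective_def power2_eq_square algebra_simps)
  then have env_c: "moreau_env h c 1 = (c - x)\<^sup>2 / 2 + h x"
    by (subst moreau_env_eq_minimum) (simp_all add: moreau_objective_def)
  have "moreau_env (\<lambda>w. - moreau_env h w 1) x 1 = moreau_objective (\<lambda>w. - moreau_env h w 1) x 1 c"
  proof (rule moreau_env_eq_minimum)
    fix w
    show "moreau_objective (\<lambda>w. - moreau_env h w 1) x 1 c
      \<le> moreau_objective (\<lambda>w. - moreau_env h w 1) x 1 w"
      using env_le[of w x] env_c by (simp add: moreau_objective_def power2_commute)
  qed
  then show ?thesis
    by (simp add: moreau_objective_def env_c power2_commute)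
qed

section \<open>The differentiable density of a random variable\<close>

text \<open>Two densities of one law differ only on a null set; where both are continuous, that set is also
  open, hence empty.\<close>

lemma (in prob_space) diff_density_eq:
  assumes nonneg: "\<And>x. 0 \<le> p x"
    and deriv: "\<And>x. p differentiable (at x)"
    and dist: "distributed M lborel H (\<lambda>x. ennreal (p x))"
  shows "diff_density M H = p"
  unfolding diff_density_def
proof (rule the_equality)
  fix q :: "real \<Rightarrow> real"
  assume q: "(\<forall>x. 0 \<le> q x) \<and> (\<forall>x. q differentiable (at x)) \<and>
    distributed M lborel H (\<lambda>x. ennreal (q x))"
  have "AE x in lborel. ennreal (q x) = ennreal (p x)"
    using q dist by (intro distributed_unique) auto
  then have ae: "AE x in lborel. q x = p x"
    using q nonneg by simp
  have cont: "continuous_on UNIV p" "continuous_on UNIV q"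
    using deriv q by (auto intro!: continuous_at_imp_continuous_on differentiable_imp_continuous_within)
  have "open {x. q x \<noteq> p x}"
    by (intro open_Collect_neq cont)
  moreover have "negligible {x. q x \<noteq> p x}"
    using AE_completion[OF ae] by (simp add: negligible_iff_null_sets completion.AE_iff_null_sets AE_iff_null_sets)
  ultimately have "{x. q x \<noteq> p x} = {}"
    using open_not_negligible by blast
  then show "q = p" by auto
qed (use assms in auto)

section \<open>Differentiating an expectation\<close>

text \<open>The mean value theorem bounds the difference quotients by the bound on the derivative, so
  dominated convergence applies.\<close>

lemma (in prob_space) has_real_derivative_expectation:
  fixes f f' :: "'a \<Rightarrow> real \<Rightarrow> real"
  assumes [measurable]: "\<And>x. (\<lambda>z. f z x) \<in> borel_measurable M"
    "\<And>x. (\<lambda>z. f' z x) \<in> borel_measurable M"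
    and int: "\<And>x. integrable M (\<lambda>z. f z x)"
    and deriv: "\<And>z x. (f z has_real_derivative f' z x) (at x)"
    and bound: "\<And>z x. \<bar>f' z x\<bar> \<le> B"
  shows "((\<lambda>x. \<integral>z. f z x \<partial>M) has_real_derivative (\<integral>z. f' z x \<partial>M)) (at x)"
  unfolding has_field_derivative_iff tendsto_at_iff_sequentially comp_def
proof (intro allI impI)
  fix X :: "nat \<Rightarrow> real"
  assume X: "\<forall>i. X i \<in> UNIV - {x}" "X \<longlonglongrightarrow> x"
  have "(\<lambda>i. \<integral>z. (f z (X i) - f z x) / (X i - x) \<partial>M) \<longlonglongrightarrow> (\<integral>z. f' z x \<partial>M)"
  proof (rule integral_dominated_convergence)
    show "AE z in M. (\<lambda>i. (f z (X i) - f z x) / (X i - x)) \<longlonglongrightarrow> f' z x"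
      using deriv X by (auto simp: has_field_derivative_iff tendsto_at_iff_sequentially comp_def)
    show "AE z in M. norm ((f z (X i) - f z x) / (X i - x)) \<le> B" for i
    proof (rule AE_I2)
      fix z
      have "norm (f z (X i) - f z x) \<le> B * norm (X i - x)"
        by (rule field_differentiable_bound[of UNIV "f z" "f' z"]) (use deriv bound in auto)
      then show "norm ((f z (X i) - f z x) / (X i - x)) \<le> B"
        using X(1) by (simp add: divide_le_eq abs_mult)
    qed
  qed auto
  then show "(\<lambda>i. ((\<integral>z. f z (X i) \<partial>M) - (\<integral>z. f z x \<partial>M)) / (X i - x)) \<longlonglongrightarrow> (\<integral>z. f' z x \<partial>M)"
    using int by simp
qed

section \<open>Gaussian kernels and square-integrable variables\<close>

text \<open>The next three bounds are uniform in mean and argument; they make the kernels below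
  integrable against every law of the mean.\<close>

lemma normal_density_le:
  "normal_density \<mu> \<sigma> x \<le> 1 / sqrt (2 * pi * \<sigma>\<^sup>2)"
proof -
  have "exp (- (x - \<mu>)\<^sup>2 / (2 * \<sigma>\<^sup>2)) \<le> 1" by simp
  then show ?thesis
    unfolding normal_density_def by (intro mult_left_le) auto
qed

lemma square_times_normal_density_le:
  assumes "0 < \<sigma>"
  shows "(\<mu> - x)\<^sup>2 * normal_density \<mu> \<sigma> x \<le> 2 * \<sigma>\<^sup>2 / sqrt (2 * pi * \<sigma>\<^sup>2)"
proof -
  define y where "y = (\<mu> - x)\<^sup>2 / (2 * \<sigma>\<^sup>2)"
  have "y \<le> exp y" using exp_ge_add_one_self[of y] by linarith
  then have "y * exp (- y) \<le> 1" by (simp add: exp_minus field_simps)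
  then have "y * exp (- y) * (2 * \<sigma>\<^sup>2 / sqrt (2 * pi * \<sigma>\<^sup>2)) \<le> 2 * \<sigma>\<^sup>2 / sqrt (2 * pi * \<sigma>\<^sup>2)"
    by (intro mult_left_le_one_le) (auto simp: y_def)
  moreover have "(\<mu> - x)\<^sup>2 * normal_density \<mu> \<sigma> x = y * exp (- y) * (2 * \<sigma>\<^sup>2 / sqrt (2 * pi * \<sigma>\<^sup>2))"
    using assms by (simp add: normal_density_def y_def power2_commute)
  ultimately show ?thesis by simp
qed

lemma abs_times_normal_density_le:
  assumes "0 < \<sigma>"
  shows "\<bar>\<mu> - x\<bar> * normal_density \<mu> \<sigma> x \<le> (1 + 2 * \<sigma>\<^sup>2) / sqrt (2 * pi * \<sigma>\<^sup>2)"
proof -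
  have "\<bar>\<mu> - x\<bar> \<le> 1 + (\<mu> - x)\<^sup>2"
    using zero_le_power2[of "\<bar>\<mu> - x\<bar> - 1 / 2"] by (simp add: power2_eq_square algebra_simps)
  then have "\<bar>\<mu> - x\<bar> * normal_density \<mu> \<sigma> x \<le> (1 + (\<mu> - x)\<^sup>2) * normal_density \<mu> \<sigma> x"
    by (intro mult_right_mono) auto
  also have "\<dots> \<le> 1 / sqrt (2 * pi * \<sigma>\<^sup>2) + 2 * \<sigma>\<^sup>2 / sqrt (2 * pi * \<sigma>\<^sup>2)"
    using normal_density_le[of \<mu> \<sigma> x] square_times_normal_density_le[OF assms, of \<mu> x]
    by (simp add: algebra_simps)
  finally show ?thesis by (simp add: add_divide_distrib)
qed

lemma has_real_derivative_normal_density: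
  assumes "0 < \<sigma>"
  shows "(normal_density \<mu> \<sigma> has_real_derivative (\<mu> - x) / \<sigma>\<^sup>2 * normal_density \<mu> \<sigma> x) (at x)"
  unfolding normal_density_def
  by (rule derivative_eq_intros refl | use assms in \<open>simp add: field_simps\<close>)+

lemma integrable_mult_of_squares:
  fixes f g :: "'a \<Rightarrow> real"
  assumes [measurable]: "f \<in> borel_measurable M" "g \<in> borel_measurable M"
    and "integrable M (\<lambda>x. (f x)\<^sup>2)" "integrable M (\<lambda>x. (g x)\<^sup>2)"
  shows "integrable M (\<lambda>x. f x * g x)"
proof (rule Bochner_Integration.integrable_bound)
  show "integrable M (\<lambda>x. (f x)\<^sup>2 + (g x)\<^sup>2)"
    using assms by simp
  have "\<bar>u * v\<bar> \<le> u\<^sup>2 + v\<^sup>2" for u v :: real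
  proof -
    have "2 * (\<bar>u\<bar> * \<bar>v\<bar>) \<le> u\<^sup>2 + v\<^sup>2" and "0 \<le> \<bar>u\<bar> * \<bar>v\<bar>"
      using zero_le_power2[of "\<bar>u\<bar> - \<bar>v\<bar>"] by (auto simp: power2_diff)
    then show ?thesis unfolding abs_mult by linarith
  qed
  then show "AE x in M. norm (f x * g x) \<le> norm ((f x)\<^sup>2 + (g x)\<^sup>2)"
    by (intro AE_I2) (simp add: order_trans[OF _ abs_ge_self])
qed simp

lemma (in prob_space)
  assumes "distributed M lborel X (\<lambda>x. ennreal (std_normal_density x))"
  shows std_normal_expectation: "integrable M X" "expectation X = 0"
    and std_normal_square_integrable: "integrable M (\<lambda>\<omega>. (X \<omega>)\<^sup>2)"
    and std_normal_expectation_square: "expectation (\<lambda>\<omega>. (X \<omega>)\<^sup>2) = 1"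
  using distributed_integrable[OF assms, of "\<lambda>x. x"] distributed_integral[OF assms, of "\<lambda>x. x"]
    distributed_integrable[OF assms, of "\<lambda>x. x\<^sup>2"] distributed_integral[OF assms, of "\<lambda>x. x\<^sup>2"]
    integrable_std_normal_moment[of 1] integral_std_normal_moment_odd[of 0]
    integrable_std_normal_moment[of 2] integral_std_normal_moment_even[of 1]
  by (simp_all add: fact_2)

section \<open>A random variable observed in Gaussian noise\<close>

locale gaussian_smoothing = prob_space M
  for M :: "'w measure" +
  fixes G Z :: "'w \<Rightarrow> real" and \<sigma> :: real
  assumes G_normal: "distributed M lborel G (\<lambda>x. ennreal (std_normal_density x))"
    and indep: "indep_var borel G borel Z"
    and sigma_pos: "0 < \<sigma>"
begin

definition law :: "real measure" where
  "law = distr M borel Z"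

definition W :: "'w \<Rightarrow> real" where
  "W \<omega> = \<sigma> * G \<omega> + Z \<omega>"

definition dens :: "real \<Rightarrow> real" where
  "dens w = (\<integral>z. normal_density z \<sigma> w \<partial>law)"

text \<open>The logarithmic derivative of \<^const>\<open>dens\<close>, with the differentiation already carried out under
  the integral sign. By Bayes' rule it is also the posterior mean of \<open>(Z - w) / \<sigma>\<^sup>2\<close> given \<open>W = w\<close>; this second
  reading is the one that the estimates use.\<close>

definition score :: "real \<Rightarrow> real" where
  "score w = (\<integral>z. (z - w) / \<sigma>\<^sup>2 * normal_density z \<sigma> w \<partial>law) / dens w"

lemma G_measurable [measurable]: "G \<in> borel_measurable M"
  using indep indep_var_rv1 by blast

lemma Z_measurable [measurable]: "Z \<in> borel_measurable M"
  using indep indep_var_rv2 by blast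

lemma W_measurable [measurable]: "W \<in> borel_measurable M"
  unfolding W_def[abs_def] by measurable

lemma sets_law [simp, measurable_cong]: "sets law = sets borel"
  by (simp add: law_def)

lemma space_law [simp]: "space law = UNIV"
  by (simp add: law_def)

sublocale law: prob_space law
  unfolding law_def by (intro prob_space_distr) measurable

sublocale lborel_law: pair_sigma_finite lborel law
  ..

lemma normal_density_measurable2 [measurable (raw)]:
  assumes "f \<in> borel_measurable N" "g \<in> borel_measurable N"
  shows "(\<lambda>x. normal_density (f x) \<sigma> (g x)) \<in> borel_measurable N"
  unfolding normal_density_def using assms by measurable

lemma dens_measurable [measurable]: "dens \<in> borel_measurable borel"
  unfolding dens_def[abs_def] by measurable

lemma score_measurable [measurable]: "score \<in> borel_measurable borel"
  unfolding score_def[abs_def] by measurable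

lemma integrable_kernel: "integrable law (\<lambda>z. normal_density z \<sigma> w)"
  by (rule law.integrable_const_bound[where B = "1 / sqrt (2 * pi * \<sigma>\<^sup>2)"])
     (auto simp: normal_density_le)

lemma integrable_centred_kernel: "integrable law (\<lambda>z. (z - w) * normal_density z \<sigma> w)"
  by (rule law.integrable_const_bound[where B = "(1 + 2 * \<sigma>\<^sup>2) / sqrt (2 * pi * \<sigma>\<^sup>2)"])
     (use abs_times_normal_density_le[OF sigma_pos] in \<open>auto simp: abs_mult intro!: AE_I2\<close>)

lemma integrable_square_kernel: "integrable law (\<lambda>z. (z - w)\<^sup>2 * normal_density z \<sigma> w)"
  by (rule law.integrable_const_bound[where B = "2 * \<sigma>\<^sup>2 / sqrt (2 * pi * \<sigma>\<^sup>2)"])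
     (use square_times_normal_density_le[OF sigma_pos] in \<open>auto simp: abs_mult intro!: AE_I2\<close>)

lemma dens_pos: "0 < dens w"
  unfolding dens_def
proof -
  have "normal_density z \<sigma> w \<noteq> 0" for z
    using normal_density_pos[OF sigma_pos, of z w] by linarith
  then have "(\<integral>z. normal_density z \<sigma> w \<partial>law) \<noteq> 0"
    by (subst integral_nonneg_eq_0_iff_AE[OF integrable_kernel]) auto
  moreover have "0 \<le> (\<integral>z. normal_density z \<sigma> w \<partial>law)"
    by (intro integral_nonneg_AE) auto
  ultimately show "0 < (\<integral>z. normal_density z \<sigma> w \<partial>law)" by linarith
qed

lemma integral_centred_kernel:
  "(\<integral>z. (z - w) * normal_density z \<sigma> w \<partial>law) = \<sigma>\<^sup>2 * score w * dens w"
proof -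
  have "(\<integral>z. (z - w) / \<sigma>\<^sup>2 * normal_density z \<sigma> w \<partial>law)
      = (\<integral>z. (z - w) * normal_density z \<sigma> w \<partial>law) / \<sigma>\<^sup>2"
    by simp
  then show ?thesis
    unfolding score_def using dens_pos[of w] sigma_pos by simp
qed

lemma dens_has_derivative: "(dens has_real_derivative score w * dens w) (at w)"
proof -
  have "((\<lambda>w. \<integral>z. normal_density z \<sigma> w \<partial>law) has_real_derivative
      (\<integral>z. (z - w) / \<sigma>\<^sup>2 * normal_density z \<sigma> w \<partial>law)) (at w)"
  proof (rule law.has_real_derivative_expectation)
    show "\<bar>(z - x) / \<sigma>\<^sup>2 * normal_density z \<sigma> x\<bar>
        \<le> (1 + 2 * \<sigma>\<^sup>2) / sqrt (2 * pi * \<sigma>\<^sup>2) / \<sigma>\<^sup>2" for z x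
      using abs_times_normal_density_le[OF sigma_pos, of z x] sigma_pos
      by (auto simp: abs_mult dest: divide_right_mono[where c = "\<sigma>\<^sup>2"])
    show "(normal_density z \<sigma> has_real_derivative (z - x) / \<sigma>\<^sup>2 * normal_density z \<sigma> x) (at x)" for z x
      by (rule has_real_derivative_normal_density[OF sigma_pos])
  qed (auto intro: integrable_kernel)
  then show ?thesis
    using dens_pos[of w] by (simp add: score_def dens_def[abs_def])
qed

lemma dens_differentiable: "dens differentiable (at w)"
  using dens_has_derivative real_differentiable_def by blast

lemma ln_dens_has_derivative: "((\<lambda>w. ln (dens w)) has_real_derivative score w) (at w)"
  using DERIV_chain2[OF DERIV_ln_divide[OF dens_pos] dens_has_derivative[of w]] dens_pos[of w]
  by simp

text \<open>Completing the square, \<open>exp (v\<^sup>2 / (2 \<sigma>\<^sup>2))\<close> times the kernel with mean \<open>z\<close> at \<open>v\<close> is a constant in \<open>v\<close>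
  times \<open>exp (v z / \<sigma>\<^sup>2)\<close>, so the left and right sides compare values of a log moment generating
  function. The slope at \<open>x\<close> is the posterior mean of \<open>Z / \<sigma>\<^sup>2\<close> given \<open>W = x\<close>, and the inequality is Jensen's for
  that posterior: bound the exponential below by its tangent line at the mean and integrate.\<close>

lemma ln_dens_support_line:
  "ln (dens x) + x\<^sup>2 / (2 * \<sigma>\<^sup>2) + (score x + x / \<sigma>\<^sup>2) * (v - x) \<le> ln (dens v) + v\<^sup>2 / (2 * \<sigma>\<^sup>2)"
proof -
  \<comment> \<open>The exponent relating the kernels at \<open>x\<close> and \<open>v\<close> splits into its posterior mean \<open>e\<close> and the
    centred deviation \<open>d z\<close>, which integrates to zero against the kernel at \<open>x\<close>.\<close>
  define e where "e = (x\<^sup>2 - v\<^sup>2) / (2 * \<sigma>\<^sup>2) + (score x + x / \<sigma>\<^sup>2) * (v - x)"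
  define d where "d z = (v - x) / \<sigma>\<^sup>2 * ((z - x) - \<sigma>\<^sup>2 * score x)" for z
  have "dens x * exp e
      = exp e * ((\<integral>z. normal_density z \<sigma> x \<partial>law)
         + (v - x) / \<sigma>\<^sup>2 * ((\<integral>z. (z - x) * normal_density z \<sigma> x \<partial>law)
            - \<sigma>\<^sup>2 * score x * (\<integral>z. normal_density z \<sigma> x \<partial>law)))"
    using integral_centred_kernel[of x] by (simp add: dens_def)
  also have "\<dots> = (\<integral>z. exp e * (normal_density z \<sigma> x
         + (v - x) / \<sigma>\<^sup>2 * ((z - x) * normal_density z \<sigma> x
            - \<sigma>\<^sup>2 * score x * normal_density z \<sigma> x)) \<partial>law)"
    using integrable_kernel[of x] integrable_centred_kernel[of x] by simp
  also have "\<dots> \<le> dens v"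
    unfolding dens_def
  proof (rule integral_mono)
    fix z
    have "normal_density z \<sigma> v = normal_density z \<sigma> x * exp (e + d z)"
      unfolding normal_density_def
      using sigma_pos
      by (simp add: mult_exp_exp e_def d_def field_simps power2_eq_square)
    moreover have "exp e * (1 + d z) \<le> exp (e + d z)"
      by (simp add: exp_add)
    ultimately have "normal_density z \<sigma> x * (exp e * (1 + d z)) \<le> normal_density z \<sigma> v"
      by (simp add: mult_left_mono)
    then show "exp e * (normal_density z \<sigma> x + (v - x) / \<sigma>\<^sup>2 * ((z - x) * normal_density z \<sigma> x
            - \<sigma>\<^sup>2 * score x * normal_density z \<sigma> x)) \<le> normal_density z \<sigma> v"
      by (simp add: d_def algebra_simps)
  qed (intro integrable_mult_right Bochner_Integration.integrable_add
        Bochner_Integration.integrable_diff integrable_kernel integrable_centred_kernel)+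
  finally have "ln (dens x * exp e) \<le> ln (dens v)"
    using dens_pos by (subst ln_le_cancel_iff) auto
  then have "ln (dens x) + e \<le> ln (dens v)"
    using dens_pos[of x] by (simp add: ln_mult)
  then show ?thesis
    by (simp add: e_def diff_divide_distrib)
qed

text \<open>Given \<open>Z = z\<close>, the variable \<open>W\<close> is normal with mean \<open>z\<close>: this is independence followed by an
  affine change of variable in the Gaussian coordinate.\<close>

lemma joint_law:
  "distr M (borel \<Otimes>\<^sub>M borel) (\<lambda>\<omega>. (W \<omega>, Z \<omega>))
    = density (lborel \<Otimes>\<^sub>M law) (\<lambda>(w, z). ennreal (normal_density z \<sigma> w))"
proof (rule measure_eqI)
  show "sets (distr M (borel \<Otimes>\<^sub>M borel) (\<lambda>\<omega>. (W \<omega>, Z \<omega>)))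
      = sets (density (lborel \<Otimes>\<^sub>M law) (\<lambda>(w, z). ennreal (normal_density z \<sigma> w)))"
    by (simp cong: sets_pair_measure_cong)
next
  fix A assume "A \<in> sets (distr M (borel \<Otimes>\<^sub>M borel) (\<lambda>\<omega>. (W \<omega>, Z \<omega>)))"
  then have A [measurable]: "A \<in> sets (borel \<Otimes>\<^sub>M borel)" by simp
  have GZ: "distr M (borel \<Otimes>\<^sub>M borel) (\<lambda>\<omega>. (G \<omega>, Z \<omega>)) = density lborel std_normal_density \<Otimes>\<^sub>M law"
    using indep distributed_distr_eq_density[OF G_normal]
    by (simp add: indep_var_distribution_eq law_def cong: distr_cong)
  interpret N: prob_space "density lborel std_normal_density"
    by (rule prob_space_normal_density) simp
  interpret N: pair_sigma_finite "density lborel std_normal_density" law ..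
  have affine: "(\<integral>\<^sup>+g. ennreal (std_normal_density g) * indicator A (\<sigma> * g + z, z) \<partial>lborel)
      = (\<integral>\<^sup>+w. ennreal (normal_density z \<sigma> w) * indicator A (w, z) \<partial>lborel)" for z
  proof -
    have [measurable]: "(\<lambda>w. indicator A (w, z) :: ennreal) \<in> borel_measurable borel"
      by measurable
    have "ennreal \<sigma> * ennreal (normal_density z \<sigma> (z + \<sigma> * g)) = ennreal (std_normal_density g)" for g
      using sigma_pos
      by (simp add: ennreal_mult'[symmetric] normal_density_def real_sqrt_mult power_mult_distrib)
    then show ?thesis
      using sigma_pos
      by (subst (2) nn_integral_real_affine[where c = \<sigma> and t = z])
         (auto simp: nn_integral_cmult[symmetric] mult.assoc[symmetric] add.commute)
  qed
  have "emeasure (distr M (borel \<Otimes>\<^sub>M borel) (\<lambda>\<omega>. (W \<omega>, Z \<omega>))) A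
      = (\<integral>\<^sup>+\<omega>. indicator A (\<sigma> * G \<omega> + Z \<omega>, Z \<omega>) \<partial>M)"
    unfolding W_def[symmetric]
    using nn_integral_distr[of "\<lambda>\<omega>. (W \<omega>, Z \<omega>)" M "borel \<Otimes>\<^sub>M borel" "indicator A"] by simp
  also have "\<dots> = (\<integral>\<^sup>+x. indicator A (\<sigma> * fst x + snd x, snd x)
      \<partial>distr M (borel \<Otimes>\<^sub>M borel) (\<lambda>\<omega>. (G \<omega>, Z \<omega>)))"
    by (subst nn_integral_distr) auto
  also have "\<dots> = (\<integral>\<^sup>+z. (\<integral>\<^sup>+g. indicator A (\<sigma> * g + z, z) \<partial>density lborel std_normal_density) \<partial>law)"
    unfolding GZ by (subst N.nn_integral_snd[symmetric]) (auto simp: case_prod_beta')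
  also have "\<dots> = (\<integral>\<^sup>+z. (\<integral>\<^sup>+w. ennreal (normal_density z \<sigma> w) * indicator A (w, z) \<partial>lborel) \<partial>law)"
    by (simp add: nn_integral_density affine)
  also have "\<dots> = (\<integral>\<^sup>+x. (case x of (w, z) \<Rightarrow> ennreal (normal_density z \<sigma> w)) * indicator A x
      \<partial>(lborel \<Otimes>\<^sub>M law))"
    by (subst lborel_law.nn_integral_snd[symmetric]) (auto simp: case_prod_beta')
  also have "\<dots> = emeasure (density (lborel \<Otimes>\<^sub>M law) (\<lambda>(w, z). ennreal (normal_density z \<sigma> w))) A"
    by (subst emeasure_density) (auto simp: case_prod_beta' cong: sets_pair_measure_cong)
  finally show "emeasure (distr M (borel \<Otimes>\<^sub>M borel) (\<lambda>\<omega>. (W \<omega>, Z \<omega>))) A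
      = emeasure (density (lborel \<Otimes>\<^sub>M law) (\<lambda>(w, z). ennreal (normal_density z \<sigma> w))) A" .
qed

lemma W_distributed: "distributed M lborel W (\<lambda>w. ennreal (dens w))"
proof -
  have "emeasure (distr M lborel W) A = emeasure (density lborel (\<lambda>w. ennreal (dens w))) A"
    if A [measurable]: "A \<in> sets borel" for A
  proof -
    have "emeasure (distr M lborel W) A
        = emeasure (distr M (borel \<Otimes>\<^sub>M borel) (\<lambda>\<omega>. (W \<omega>, Z \<omega>))) (A \<times> UNIV)"
      by (subst (1 2) emeasure_distr) (auto intro!: arg_cong[where f = "emeasure M"])
    also have "\<dots> = (\<integral>\<^sup>+x. (case x of (w, z) \<Rightarrow> ennreal (normal_density z \<sigma> w)) * indicator (A \<times> UNIV) x
        \<partial>(lborel \<Otimes>\<^sub>M law))"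
      unfolding joint_law by (subst emeasure_density) auto
    also have "\<dots> = (\<integral>\<^sup>+w. (\<integral>\<^sup>+z. ennreal (normal_density z \<sigma> w) * indicator A w \<partial>law) \<partial>lborel)"
      by (subst law.nn_integral_fst[symmetric]) (auto simp: indicator_times)
    also have "\<dots> = (\<integral>\<^sup>+w. ennreal (dens w) * indicator A w \<partial>lborel)"
      by (simp add: nn_integral_multc nn_integral_eq_integral integrable_kernel dens_def)
    also have "\<dots> = emeasure (density lborel (\<lambda>w. ennreal (dens w))) A"
      by (subst emeasure_density) auto
    finally show ?thesis .
  qed
  then show ?thesis
    by (auto simp: distributed_def intro!: measure_eqI)
qed

text \<open>Integrating out \<open>Z\<close> first reduces expectations of functions of \<open>(W, Z)\<close> to integrals against
  the kernel over the law of \<open>Z\<close>, where \<^const>\<open>dens\<close> and \<^const>\<open>score\<close> appear.\<close>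

lemma joint_expectation:
  assumes F [measurable]: "F \<in> borel_measurable (borel \<Otimes>\<^sub>M borel)"
    and int: "integrable M (\<lambda>\<omega>. F (W \<omega>, Z \<omega>))"
  shows "integrable lborel (\<lambda>w. \<integral>z. F (w, z) * normal_density z \<sigma> w \<partial>law)" (is ?I)
    and "expectation (\<lambda>\<omega>. F (W \<omega>, Z \<omega>)) = (\<integral>w. (\<integral>z. F (w, z) * normal_density z \<sigma> w \<partial>law) \<partial>lborel)" (is ?E)
proof -
  let ?D = "distr M (borel \<Otimes>\<^sub>M borel) (\<lambda>\<omega>. (W \<omega>, Z \<omega>))"
  let ?\<phi> = "\<lambda>x. normal_density (snd x) \<sigma> (fst x)"
  have D: "?D = density (lborel \<Otimes>\<^sub>M law) (\<lambda>x. ennreal (?\<phi> x))"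
    using joint_law by (simp add: case_prod_beta')
  have "integrable ?D F"
    using int by (simp add: integrable_distr_eq)
  then have *: "integrable (lborel \<Otimes>\<^sub>M law) (\<lambda>x. F x * ?\<phi> x)"
    unfolding D by (subst (asm) integrable_density) (auto simp: mult.commute)
  show ?I using lborel_law.integrable_fst'[OF *] by simp
  have "expectation (\<lambda>\<omega>. F (W \<omega>, Z \<omega>)) = integral\<^sup>L ?D F"
    by (simp add: integral_distr)
  also have "\<dots> = integral\<^sup>L (lborel \<Otimes>\<^sub>M law) (\<lambda>x. F x * ?\<phi> x)"
    unfolding D by (subst integral_density) (auto simp: mult.commute)
  also have "\<dots> = (\<integral>w. (\<integral>z. F (w, z) * normal_density z \<sigma> w \<partial>law) \<partial>lborel)"
    using lborel_law.integral_fst'[OF *] by simp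
  finally show ?E .
qed

text \<open>Since \<open>\<sigma> G = W - Z\<close>, integrating \<open>G g(W)\<close> over \<open>Z\<close> for fixed \<open>W = w\<close> produces the posterior
  mean of \<open>w - Z\<close>, which is \<open>- \<sigma>\<^sup>2\<close> times the score. Integrability passes through the same
  computation.\<close>

lemma
  assumes g [measurable]: "g \<in> borel_measurable borel"
    and int: "integrable M (\<lambda>\<omega>. G \<omega> * g (W \<omega>))"
  shows score_integrable: "integrable M (\<lambda>\<omega>. g (W \<omega>) * score (W \<omega>))"
    and tweedie: "\<sigma> * expectation (\<lambda>\<omega>. g (W \<omega>) * score (W \<omega>)) = - expectation (\<lambda>\<omega>. G \<omega> * g (W \<omega>))"
proof -
  let ?F = "\<lambda>x. g (fst x) * (snd x - fst x)"
  have F: "?F (W \<omega>, Z \<omega>) = - \<sigma> * (G \<omega> * g (W \<omega>))" for \<omega>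
    by (simp add: W_def)
  have inner: "(\<integral>z. ?F (w, z) * normal_density z \<sigma> w \<partial>law) = \<sigma>\<^sup>2 * (dens w * (g w * score w))" for w
    using integral_centred_kernel[of w] by (simp add: mult.assoc)
  have "integrable M (\<lambda>\<omega>. ?F (W \<omega>, Z \<omega>))"
    unfolding F using int by simp
  note joint = joint_expectation[of ?F, OF _ this, unfolded inner F]
  have "integrable lborel (\<lambda>w. dens w * (g w * score w))"
    using joint(1) sigma_pos by simp
  then show "integrable M (\<lambda>\<omega>. g (W \<omega>) * score (W \<omega>))"
    by (subst (asm) distributed_integrable[OF W_distributed]) (auto simp: dens_pos less_imp_le)
  have "(\<integral>w. dens w * (g w * score w) \<partial>lborel) = expectation (\<lambda>\<omega>. g (W \<omega>) * score (W \<omega>))"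
    by (subst distributed_integral[OF W_distributed]) (auto simp: dens_pos less_imp_le)
  then have "\<sigma> * (\<sigma> * expectation (\<lambda>\<omega>. g (W \<omega>) * score (W \<omega>))) = \<sigma> * (- expectation (\<lambda>\<omega>. G \<omega> * g (W \<omega>)))"
    using joint(2) by (simp add: power2_eq_square)
  then show "\<sigma> * expectation (\<lambda>\<omega>. g (W \<omega>) * score (W \<omega>)) = - expectation (\<lambda>\<omega>. G \<omega> * g (W \<omega>))"
    using sigma_pos by (subst (asm) mult_left_cancel) auto
qed

lemmas G_square_integrable = std_normal_square_integrable[OF G_normal]

text \<open>The squared posterior mean of \<open>Z - w\<close> is at most its posterior second moment; the difference is the
  posterior variance, an integral of squares.\<close>

lemma score_square_dens_le:
  "\<sigma>\<^sup>2 * \<sigma>\<^sup>2 * (dens w * (score w)\<^sup>2) \<le> (\<integral>z. (z - w)\<^sup>2 * normal_density z \<sigma> w \<partial>law)"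
proof -
  let ?c = "\<sigma>\<^sup>2 * score w"
  have "0 \<le> (\<integral>z. (z - w - ?c)\<^sup>2 * normal_density z \<sigma> w \<partial>law)"
    by (intro integral_nonneg_AE) auto
  also have "\<dots> = (\<integral>z. (z - w)\<^sup>2 * normal_density z \<sigma> w - 2 * ?c * ((z - w) * normal_density z \<sigma> w)
      + ?c\<^sup>2 * normal_density z \<sigma> w \<partial>law)"
    by (intro Bochner_Integration.integral_cong) (auto simp: power2_eq_square algebra_simps)
  also have "\<dots> = (\<integral>z. (z - w)\<^sup>2 * normal_density z \<sigma> w \<partial>law)
      - 2 * ?c * (\<integral>z. (z - w) * normal_density z \<sigma> w \<partial>law) + ?c\<^sup>2 * dens w"
    using integrable_kernel[of w] integrable_centred_kernel[of w] integrable_square_kernel[of w]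
    by (simp add: dens_def)
  finally show ?thesis
    unfolding integral_centred_kernel by (simp add: power2_eq_square algebra_simps)
qed

text \<open>The bound of the previous lemma integrates over \<open>w\<close> to \<open>E[(\<sigma> G)\<^sup>2]\<close>, which is finite.\<close>

lemma score_square_integrable: "integrable M (\<lambda>\<omega>. (score (W \<omega>))\<^sup>2)"
proof -
  let ?F = "\<lambda>x. (snd x - fst x)\<^sup>2 :: real"
  have "integrable M (\<lambda>\<omega>. ?F (W \<omega>, Z \<omega>))"
    using G_square_integrable by (simp add: W_def power_mult_distrib)
  then have "integrable lborel (\<lambda>w. \<integral>z. (z - w)\<^sup>2 * normal_density z \<sigma> w \<partial>law)"
    using joint_expectation(1)[of ?F] by simp
  then have "integrable lborel (\<lambda>w. \<sigma>\<^sup>2 * \<sigma>\<^sup>2 * (dens w * (score w)\<^sup>2))"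
    by (rule Bochner_Integration.integrable_bound)
       (use score_square_dens_le in \<open>auto intro!: AE_I2 simp: dens_pos less_imp_le abs_mult abs_of_nonneg
          intro: order_trans[OF _ abs_ge_self]\<close>)
  then have "integrable lborel (\<lambda>w. dens w * (score w)\<^sup>2)"
    using sigma_pos by simp
  then show ?thesis
    by (subst (asm) distributed_integrable[OF W_distributed]) (auto simp: dens_pos less_imp_le)
qed

lemma diff_density_W: "diff_density M W = dens"
  by (intro diff_density_eq W_distributed dens_differentiable) (simp add: dens_pos less_imp_le)

lemma fisher_info_W: "fisher_info M W = expectation (\<lambda>\<omega>. (score (W \<omega>))\<^sup>2)"
proof -
  have "deriv dens w / dens w = score w" for w
    using DERIV_imp_deriv[OF dens_has_derivative[of w]] dens_pos[of w] by simp
  then show ?thesis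
    unfolding fisher_info_def diff_density_W by simp
qed

end

text \<open>A signal of unit power, such as \<open>S Y\<close> with a sign \<open>Y\<close>. The normalization turns the second moments
  of \<open>W\<close>, \<open>G\<close>, \<open>Z\<close> and the score into polynomials in \<open>\<sigma>\<close> and the Fisher information.\<close>

locale unit_gaussian_smoothing = gaussian_smoothing +
  assumes Z_square_integrable: "integrable M (\<lambda>\<omega>. (Z \<omega>)\<^sup>2)"
    and expectation_Z_square: "expectation (\<lambda>\<omega>. (Z \<omega>)\<^sup>2) = 1"
begin

abbreviation info :: real where
  "info \<equiv> fisher_info M W"

lemma integrable_products:
  "integrable M (\<lambda>\<omega>. G \<omega> * Z \<omega>)"
  "integrable M (\<lambda>\<omega>. G \<omega> * score (W \<omega>))"
  "integrable M (\<lambda>\<omega>. Z \<omega> * score (W \<omega>))"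
  using G_square_integrable Z_square_integrable score_square_integrable
  by (auto intro!: integrable_mult_of_squares)

lemma expectation_G_Z: "expectation (\<lambda>\<omega>. G \<omega> * Z \<omega>) = 0"
  using indep_var_lebesgue_integral[OF indep std_normal_expectation(1)[OF G_normal]
      square_integrable_imp_integrable[OF Z_measurable Z_square_integrable]]
  by (simp add: std_normal_expectation(2)[OF G_normal])

lemma expectation_G_score: "expectation (\<lambda>\<omega>. G \<omega> * score (W \<omega>)) = - \<sigma> * info"
  using tweedie[OF score_measurable integrable_products(2)]
  by (simp add: fisher_info_W power2_eq_square)

text \<open>Tweedie's identity with the identity function gives \<open>E[W \<xi>(W)] = -1\<close>; subtracting the part of \<open>W\<close> that
  comes from \<open>G\<close> leaves the claim.\<close>

lemma expectation_Z_score: "expectation (\<lambda>\<omega>. Z \<omega> * score (W \<omega>)) = \<sigma>\<^sup>2 * info - 1"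
proof -
  have GW: "G \<omega> * W \<omega> = \<sigma> * (G \<omega>)\<^sup>2 + G \<omega> * Z \<omega>" for \<omega>
    by (simp add: W_def power2_eq_square algebra_simps)
  have "integrable M (\<lambda>\<omega>. G \<omega> * W \<omega>)" and "expectation (\<lambda>\<omega>. G \<omega> * W \<omega>) = \<sigma>"
    unfolding GW using integrable_products(1) G_square_integrable std_normal_expectation_square[OF G_normal] expectation_G_Z
    by simp_all
  then have "\<sigma> * expectation (\<lambda>\<omega>. W \<omega> * score (W \<omega>)) = \<sigma> * -1"
    using tweedie[of "\<lambda>x. x"] by simp
  then have "expectation (\<lambda>\<omega>. W \<omega> * score (W \<omega>)) = -1"
    using sigma_pos by (subst (asm) mult_left_cancel) auto
  moreover have "expectation (\<lambda>\<omega>. W \<omega> * score (W \<omega>))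
      = \<sigma> * expectation (\<lambda>\<omega>. G \<omega> * score (W \<omega>)) + expectation (\<lambda>\<omega>. Z \<omega> * score (W \<omega>))"
    using integrable_products by (simp add: W_def distrib_right mult.assoc)
  ultimately show ?thesis
    by (simp add: expectation_G_score power2_eq_square)
qed

text \<open>These are the three expectations of the system for an envelope derivative \<open>- (a x + b \<xi>(x))\<close>
  evaluated at \<open>W\<close>.\<close>

lemma second_moments:
  fixes a b :: real
  defines "m \<equiv> \<lambda>\<omega>. a * W \<omega> + b * score (W \<omega>)"
  shows "expectation (\<lambda>\<omega>. Z \<omega> * m \<omega>) = a - b * (1 - \<sigma>\<^sup>2 * info)"
    and "expectation (\<lambda>\<omega>. G \<omega> * m \<omega>) = \<sigma> * (a - b * info)"
    and "expectation (\<lambda>\<omega>. (m \<omega>)\<^sup>2) = a\<^sup>2 * (1 + \<sigma>\<^sup>2) - 2 * a * b + b\<^sup>2 * info"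
proof -
  note moments = integrable_products G_square_integrable Z_square_integrable score_square_integrable
    std_normal_expectation_square[OF G_normal] expectation_Z_square expectation_G_Z expectation_G_score expectation_Z_score
  have "Z \<omega> * m \<omega> = a * \<sigma> * (G \<omega> * Z \<omega>) + a * (Z \<omega>)\<^sup>2 + b * (Z \<omega> * score (W \<omega>))" for \<omega>
    by (simp add: m_def W_def power2_eq_square algebra_simps)
  then show "expectation (\<lambda>\<omega>. Z \<omega> * m \<omega>) = a - b * (1 - \<sigma>\<^sup>2 * info)"
    using moments by (simp add: right_diff_distrib)
  have "G \<omega> * m \<omega> = a * \<sigma> * (G \<omega>)\<^sup>2 + a * (G \<omega> * Z \<omega>) + b * (G \<omega> * score (W \<omega>))" for \<omega>
    by (simp add: m_def W_def power2_eq_square algebra_simps)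
  then show "expectation (\<lambda>\<omega>. G \<omega> * m \<omega>) = \<sigma> * (a - b * info)"
    using moments by (simp add: algebra_simps)
  have "(m \<omega>)\<^sup>2 = a\<^sup>2 * \<sigma>\<^sup>2 * (G \<omega>)\<^sup>2 + a\<^sup>2 * (Z \<omega>)\<^sup>2 + b\<^sup>2 * (score (W \<omega>))\<^sup>2
      + 2 * a\<^sup>2 * \<sigma> * (G \<omega> * Z \<omega>) + 2 * a * b * \<sigma> * (G \<omega> * score (W \<omega>))
      + 2 * a * b * (Z \<omega> * score (W \<omega>))" for \<omega>
  proof -
    define t where "t = score (W \<omega>)"
    show ?thesis
      unfolding m_def t_def[symmetric] by (simp add: W_def power2_eq_square algebra_simps)
  qed
  then have "expectation (\<lambda>\<omega>. (m \<omega>)\<^sup>2) = a\<^sup>2 * \<sigma>\<^sup>2 + a\<^sup>2 + b\<^sup>2 * info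
      + 2 * a * b * \<sigma> * (- \<sigma> * info) + 2 * a * b * (\<sigma>\<^sup>2 * info - 1)"
    using moments by (simp add: fisher_info_W[symmetric])
  then show "expectation (\<lambda>\<omega>. (m \<omega>)\<^sup>2) = a\<^sup>2 * (1 + \<sigma>\<^sup>2) - 2 * a * b + b\<^sup>2 * info"
    by (simp add: power2_eq_square algebra_simps)
qed

lemma cramer_rao: "1 \<le> (1 + \<sigma>\<^sup>2) * info"
proof -
  \<comment> \<open>If \<open>W\<close> were normal, its score would be \<open>- W / (1 + \<sigma>\<^sup>2)\<close>; the variance left over by this guess is
    nonnegative. The factor \<open>1\<close> matches the form \<open>a * W + b * score\<close>.\<close>
  have "0 \<le> expectation (\<lambda>\<omega>. (1 * W \<omega> + (1 + \<sigma>\<^sup>2) * score (W \<omega>))\<^sup>2)"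
    by simp
  also have "\<dots> = (1 + \<sigma>\<^sup>2) * ((1 + \<sigma>\<^sup>2) * info - 1)"
    unfolding second_moments by (simp add: power2_eq_square algebra_simps)
  finally have "0 \<le> (1 + \<sigma>\<^sup>2) * ((1 + \<sigma>\<^sup>2) * info - 1)" .
  moreover have "0 < 1 + \<sigma>\<^sup>2" by (simp add: add_pos_nonneg)
  ultimately show ?thesis by (simp add: zero_le_mult_iff)
qed

end


section \<open>Score losses\<close>

context unit_gaussian_smoothing
begin

text \<open>The relation between \<open>a\<close> and \<open>b\<close> is the one for which \<open>h + q\<close> is a nonnegative multiple of the
  function with support lines in \<open>ln_dens_support_line\<close>. Then \<open>- h\<close> is the envelope of the loss, and
  it can be differentiated directly.\<close>

lemma moreau_deriv_score_loss:
  fixes a b :: real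
  defines "h \<equiv> \<lambda>x. a * (x\<^sup>2 / 2) + b * ln (dens x)"
  assumes b: "0 \<le> b" and ab: "1 + a = b / \<sigma>\<^sup>2"
    and attained: "\<And>w. \<exists>v\<^sub>0. \<forall>v. moreau_objective h w 1 v\<^sub>0 \<le> moreau_objective h w 1 v"
  shows "moreau_deriv (\<lambda>w. - moreau_env h w 1) x 1 = - (a * x + b * score x)"
proof -
  have "moreau_env (\<lambda>w. - moreau_env h w 1) t 1 = - h t" for t
  proof (rule moreau_env_neg_moreau_env[OF attained])
    fix v
    have h: "h u + u\<^sup>2 / 2 = b * (ln (dens u) + u\<^sup>2 / (2 * \<sigma>\<^sup>2))" for u
    proof -
      have "h u + u\<^sup>2 / 2 = b * ln (dens u) + (1 + a) * u\<^sup>2 / 2"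
        by (simp add: h_def algebra_simps add_divide_distrib)
      then show ?thesis by (simp add: ab algebra_simps)
    qed
    show "h t + t\<^sup>2 / 2 + b * (score t + t / \<sigma>\<^sup>2) * (v - t) \<le> h v + v\<^sup>2 / 2"
      unfolding h using mult_left_mono[OF ln_dens_support_line[of t v] b] by (simp add: algebra_simps)
  qed
  moreover have "((\<lambda>t. - h t) has_real_derivative - (a * x + b * score x)) (at x)"
    unfolding h_def
    by (rule derivative_eq_intros ln_dens_has_derivative refl | simp)+
  ultimately show ?thesis
    by (simp add: moreau_deriv_def DERIV_imp_deriv)
qed

text \<open>With \<open>D\<close> and \<open>N\<close> for the two factors of \<open>\<kappa> = \<sigma>\<^sup>2 D / N\<close>, the hypothesis reads
  \<open>N = \<delta> \<sigma>\<^sup>2 D\<close>. As the value of \<open>\<kappa>\<close> is not zero, neither factor vanishes, so that the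
  Cramer-Rao inequality \<open>0 \<le> D\<close> becomes strict. The quadratic expression in \<open>a\<close> and \<open>b\<close> equals
  \<open>b\<^sup>2 D N\<close>.\<close>

lemma optimal_coefficients:
  fixes \<delta> a b D :: real
  defines "D \<equiv> \<sigma>\<^sup>2 * info + info - 1"
  defines "a \<equiv> (1 - \<sigma>\<^sup>2 * info) / (\<delta> * D)" and "b \<equiv> 1 / (\<delta> * D)"
  assumes delta: "0 < \<delta>" and kappa: "\<sigma>\<^sup>2 * D / (1 + \<sigma>\<^sup>2 * (\<sigma>\<^sup>2 * info - 1)) = 1 / \<delta>"
  shows "0 \<le> b"
    and "1 + a = b / \<sigma>\<^sup>2"
    and "a - b * (1 - \<sigma>\<^sup>2 * info) = 0"
    and "\<delta> * (a\<^sup>2 * (1 + \<sigma>\<^sup>2) - 2 * a * b + b\<^sup>2 * info) = \<sigma>\<^sup>2"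
    and "\<delta> * (b * info - a) = 1"
proof -
  let ?N = "1 + \<sigma>\<^sup>2 * (\<sigma>\<^sup>2 * info - 1)"
  have nz: "D \<noteq> 0" "?N \<noteq> 0"
    using kappa delta by auto
  have "0 \<le> D"
    using cramer_rao by (simp add: D_def algebra_simps)
  with nz have D: "0 < D" by simp
  have N: "?N = \<delta> * \<sigma>\<^sup>2 * D"
    using kappa delta nz by (simp add: field_simps)
  show "0 \<le> b" using D delta by (simp add: b_def)
  show "1 + a = b / \<sigma>\<^sup>2"
  proof -
    have "\<sigma>\<^sup>2 * (\<delta> * D) + \<sigma>\<^sup>2 * (1 - \<sigma>\<^sup>2 * info) = 1"
      using N by (simp add: algebra_simps)
    then have "\<sigma>\<^sup>2 * (\<delta> * D + (1 - \<sigma>\<^sup>2 * info)) = 1" by (simp add: distrib_left)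
    then have "(\<delta> * D + (1 - \<sigma>\<^sup>2 * info)) = 1 / \<sigma>\<^sup>2"
      using sigma_pos by (simp add: field_simps)
    then have "(\<delta> * D + (1 - \<sigma>\<^sup>2 * info)) / (\<delta> * D) = 1 / (\<delta> * D) / \<sigma>\<^sup>2" by simp
    then show ?thesis using D delta by (simp add: a_def b_def add_divide_distrib)
  qed
  show 1: "a - b * (1 - \<sigma>\<^sup>2 * info) = 0" by (simp add: a_def b_def)
  have b: "\<delta> * b * D = 1" using D delta by (simp add: b_def)
  have a: "a = b * (1 - \<sigma>\<^sup>2 * info)" using 1 by simp
  have "\<delta> * (b * info - a) = \<delta> * b * D"
    by (simp add: a D_def algebra_simps)
  with b show "\<delta> * (b * info - a) = 1" by simp
  have "b * ?N = \<sigma>\<^sup>2 * (\<delta> * b * D)"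
    unfolding N by (simp add: algebra_simps)
  with b have bN: "b * ?N = \<sigma>\<^sup>2" by simp
  have "\<delta> * (a\<^sup>2 * (1 + \<sigma>\<^sup>2) - 2 * a * b + b\<^sup>2 * info) = (\<delta> * b * D) * (b * ?N)"
    by (simp add: a D_def power2_eq_square algebra_simps)
  then show "\<delta> * (a\<^sup>2 * (1 + \<sigma>\<^sup>2) - 2 * a * b + b\<^sup>2 * info) = \<sigma>\<^sup>2"
    unfolding b bN by simp
qed

lemma score_loss_solves_system:
  fixes a b \<delta> :: real
  assumes Z: "Z = (\<lambda>\<omega>. S \<omega> * Y \<omega>)"
    and deriv: "\<And>x. moreau_deriv l x 1 = - (a * x + b * score x)"
    and "a - b * (1 - \<sigma>\<^sup>2 * info) = 0"
    and "\<delta> * (a\<^sup>2 * (1 + \<sigma>\<^sup>2) - 2 * a * b + b\<^sup>2 * info) = \<sigma>\<^sup>2"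
    and "\<delta> * (b * info - a) = 1"
  shows "solves_system M G S Y \<delta> l (1, \<sigma>, 1)"
proof -
  have Z_apply: "Z \<omega> = S \<omega> * Y \<omega>" for \<omega>
    by (subst Z) simp
  then have W: "\<sigma> * G \<omega> + S \<omega> * Y \<omega> = W \<omega>" and YS: "Y \<omega> * S \<omega> = Z \<omega>" for \<omega>
    by (simp_all add: W_def)
  let ?m = "\<lambda>\<omega>. moreau_deriv l (\<sigma> * G \<omega> + 1 * S \<omega> * Y \<omega>) 1"
  have m: "?m \<omega> = - (a * W \<omega> + b * score (W \<omega>))" for \<omega>
    by (simp add: W deriv)
  have "expectation (\<lambda>\<omega>. Y \<omega> * S \<omega> * ?m \<omega>) = 0"
    unfolding m YS mult_minus_right integral_minus second_moments using assms(3) by simp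
  moreover have "1\<^sup>2 * \<delta> * expectation (\<lambda>\<omega>. (?m \<omega>)\<^sup>2) = \<sigma>\<^sup>2"
    unfolding m power2_minus second_moments using assms(4) by simp
  moreover have "1 * \<delta> * expectation (\<lambda>\<omega>. G \<omega> * ?m \<omega>) = \<sigma> * (\<delta> * (b * info - a))"
    unfolding m mult_minus_right integral_minus second_moments by (simp add: algebra_simps)
  ultimately show ?thesis
    using assms(5) sigma_pos unfolding solves_system_def by simp
qed

end

section \<open>The label model\<close>

text \<open>The model separates \<open>G\<close> from \<open>S\<close> and the pair \<open>(G, S)\<close> from the seed \<open>U\<close>. On rectangles these two
  factorizations combine to make \<open>G\<close> independent of the pair \<open>(S, U)\<close>, and \<open>S Y\<close> is a function of that pair.\<close>

lemma label_model_indep: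
  assumes "label_model M G S N U f Y"
  shows "prob_space.indep_var M borel G borel (\<lambda>\<omega>. S \<omega> * Y \<omega>)"
proof -
  interpret prob_space M using assms by (simp add: label_model_def)
  have GS: "indep_var borel G borel S"
    and U [measurable]: "U \<in> M \<rightarrow>\<^sub>M N"
    and GSU: "indep_set {(\<lambda>\<omega>. (G \<omega>, S \<omega>)) -` A \<inter> space M |A. A \<in> sets (borel \<Otimes>\<^sub>M borel)}
       {U -` B \<inter> space M |B. B \<in> sets N}"
    and f [measurable]: "(\<lambda>(s, u). f s u) \<in> borel_measurable (borel \<Otimes>\<^sub>M N)"
    and Y: "\<And>\<omega>. \<omega> \<in> space M \<Longrightarrow> Y \<omega> = f (S \<omega>) (U \<omega>)"
    using assms by (simp_all add: label_model_def)
  have [measurable]: "G \<in> borel_measurable M" "S \<in> borel_measurable M"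
    using GS indep_var_rv1 indep_var_rv2 by blast+
  let ?A = "{G -` A \<inter> space M |A. A \<in> sets borel}"
  let ?R = "{(\<lambda>\<omega>. (S \<omega>, U \<omega>)) -` C \<inter> space M |C. C \<in> {D \<times> E |D E. D \<in> sets borel \<and> E \<in> sets N}}"
  have split: "prob (G -` A \<inter> space M \<inter> (S -` D \<inter> U -` E \<inter> space M))
      = prob (G -` A \<inter> space M) * prob (S -` D \<inter> space M) * prob (U -` E \<inter> space M)"
    if "A \<in> sets borel" "D \<in> sets borel" "E \<in> sets N" for A D E
  proof -
    have "prob ((\<lambda>\<omega>. (G \<omega>, S \<omega>)) -` (A \<times> D) \<inter> space M \<inter> (U -` E \<inter> space M))
      = prob ((\<lambda>\<omega>. (G \<omega>, S \<omega>)) -` (A \<times> D) \<inter> space M) * prob (U -` E \<inter> space M)"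
      using that by (intro indep_setD[OF GSU]) auto
    moreover have "(\<lambda>\<omega>. (G \<omega>, S \<omega>)) -` (A \<times> D) \<inter> space M \<inter> (U -` E \<inter> space M)
        = G -` A \<inter> space M \<inter> (S -` D \<inter> U -` E \<inter> space M)"
      by auto
    ultimately show ?thesis
      using indep_varD[OF GS that(1,2)] by simp
  qed
  have "indep_set ?A ?R"
  proof (rule indep_setI)
    fix a r assume "a \<in> ?A" "r \<in> ?R"
    then obtain A D E where *: "A \<in> sets borel" "D \<in> sets borel" "E \<in> sets N"
      and a: "a = G -` A \<inter> space M" and r: "r = (\<lambda>\<omega>. (S \<omega>, U \<omega>)) -` (D \<times> E) \<inter> space M"
      by blast
    have r: "r = S -` D \<inter> U -` E \<inter> space M" unfolding r by auto
    \<comment> \<open>Taking the first event to be the whole space factorizes the second one.\<close>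
    have "prob r = prob (S -` D \<inter> space M) * prob (U -` E \<inter> space M)"
      using split[of UNIV D E] * by (simp add: r prob_space Int_absorb1)
    then show "prob (a \<inter> r) = prob a * prob r"
      using split[OF *] by (simp add: a r)
  qed auto
  moreover have "Int_stable ?A"
  proof (rule Int_stableI)
    fix a a' assume "a \<in> ?A" "a' \<in> ?A"
    then obtain A A' where "A \<in> sets borel" "A' \<in> sets borel"
      and "a = G -` A \<inter> space M" "a' = G -` A' \<inter> space M"
      by blast
    then have "A \<inter> A' \<in> sets borel" "a \<inter> a' = G -` (A \<inter> A') \<inter> space M"
      by auto
    then show "a \<inter> a' \<in> ?A" by blast
  qed
  moreover have "Int_stable ?R"
  proof (rule Int_stableI)
    fix r r' assume "r \<in> ?R" "r' \<in> ?R"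
    then obtain D E D' E' where "D \<in> sets borel" "E \<in> sets N" "D' \<in> sets borel" "E' \<in> sets N"
      and "r = (\<lambda>\<omega>. (S \<omega>, U \<omega>)) -` (D \<times> E) \<inter> space M"
      and "r' = (\<lambda>\<omega>. (S \<omega>, U \<omega>)) -` (D' \<times> E') \<inter> space M"
      by blast
    then have "D \<inter> D' \<in> sets borel" "E \<inter> E' \<in> sets N"
      and "r \<inter> r' = (\<lambda>\<omega>. (S \<omega>, U \<omega>)) -` ((D \<inter> D') \<times> (E \<inter> E')) \<inter> space M"
      by auto
    then show "r \<inter> r' \<in> ?R" by blast
  qed
  ultimately have "indep_set (sigma_sets (space M) ?A) (sigma_sets (space M) ?R)"
    by (rule indep_set_sigma_sets)
  moreover have "sigma_sets (space M) {(\<lambda>\<omega>. S \<omega> * Y \<omega>) -` B \<inter> space M |B. B \<in> sets borel}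
      \<subseteq> sigma_sets (space M) ?R"
  proof (rule sigma_sets_mono, safe)
    fix B :: "real set" assume "B \<in> sets borel"
    let ?g = "\<lambda>(s, u). s * f s u"
    have g: "?g \<in> borel_measurable (borel \<Otimes>\<^sub>M N)" by measurable
    have "?g -` B \<inter> space (borel \<Otimes>\<^sub>M N) \<in> sigma_sets (UNIV \<times> space N)
        {D \<times> E |D E. D \<in> sets borel \<and> E \<in> sets N}"
      using measurable_sets[OF g \<open>B \<in> sets borel\<close>] by (simp add: sets_pair_measure)
    moreover have "{(\<lambda>\<omega>. (S \<omega>, U \<omega>)) -` C \<inter> space M |C. C \<in> sigma_sets (UNIV \<times> space N)
        {D \<times> E |D E. D \<in> sets borel \<and> E \<in> sets N}} = sigma_sets (space M) ?R"
      by (rule sigma_sets_vimage_commute) (use measurable_space[OF U] in auto)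
    ultimately have "(\<lambda>\<omega>. (S \<omega>, U \<omega>)) -` (?g -` B \<inter> space (borel \<Otimes>\<^sub>M N)) \<inter> space M
        \<in> sigma_sets (space M) ?R"
      by blast
    moreover have "(\<lambda>\<omega>. (S \<omega>, U \<omega>)) -` (?g -` B \<inter> space (borel \<Otimes>\<^sub>M N)) \<inter> space M
        = (\<lambda>\<omega>. S \<omega> * Y \<omega>) -` B \<inter> space M"
      using Y measurable_space[OF U] by (auto simp: space_pair_measure)
    ultimately show "(\<lambda>\<omega>. S \<omega> * Y \<omega>) -` B \<inter> space M \<in> sigma_sets (space M) ?R"
      by simp
  qed
  ultimately have "indep_set (sigma_sets (space M) ?A)
      (sigma_sets (space M) {(\<lambda>\<omega>. S \<omega> * Y \<omega>) -` B \<inter> space M |B. B \<in> sets borel})"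
    unfolding indep_set_def by - (erule indep_sets_mono_sets, simp split: bool.split)
  moreover have "(\<lambda>\<omega>. S \<omega> * Y \<omega>) \<in> borel_measurable M"
    by (subst measurable_cong[OF arg_cong2[where f = "(*)", OF refl Y]]) measurable
  ultimately show ?thesis
    by (simp add: indep_var_eq)
qed

lemma label_model_unit_gaussian_smoothing:
  assumes model: "label_model M G S N U f Y" and "0 < \<sigma>"
  shows "unit_gaussian_smoothing M G (\<lambda>\<omega>. S \<omega> * Y \<omega>) \<sigma>"
proof -
  interpret prob_space M using model by (simp add: label_model_def)
  have S: "distributed M lborel S (\<lambda>x. ennreal (std_normal_density x))"
    and G: "distributed M lborel G (\<lambda>x. ennreal (std_normal_density x))"
    and U: "U \<in> M \<rightarrow>\<^sub>M N" and Y: "\<And>\<omega>. \<omega> \<in> space M \<Longrightarrow> Y \<omega> = f (S \<omega>) (U \<omega>)"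
    and f: "\<And>s u. u \<in> space N \<Longrightarrow> f s u \<in> {-1, 1}"
    using model by (auto simp: label_model_def)
  have sq: "(S \<omega> * Y \<omega>)\<^sup>2 = (S \<omega>)\<^sup>2" if "\<omega> \<in> space M" for \<omega>
    using f[OF measurable_space[OF U that], of "S \<omega>"] Y[OF that] by auto
  show ?thesis
  proof
    show "distributed M lborel G (\<lambda>x. ennreal (std_normal_density x))" by (rule G)
    show "indep_var borel G borel (\<lambda>\<omega>. S \<omega> * Y \<omega>)" by (rule label_model_indep[OF model])
    show "0 < \<sigma>" by fact
    show "integrable M (\<lambda>\<omega>. (S \<omega> * Y \<omega>)\<^sup>2)"
      using std_normal_square_integrable[OF S] sq by (simp cong: Bochner_Integration.integrable_cong)
    show "expectation (\<lambda>\<omega>. (S \<omega> * Y \<omega>)\<^sup>2) = 1"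
      using std_normal_expectation_square[OF S] sq by (simp cong: Bochner_Integration.integral_cong)
  qed
qed

section \<open>Optimality\<close>

theorem theorem3p2:
  fixes M :: "'w measure" and N :: "'u measure"
    and G S Y :: "'w \<Rightarrow> real" and U :: "'w \<Rightarrow> 'u"
    and f :: "real \<Rightarrow> 'u \<Rightarrow> real" and \<delta> :: real
  assumes model: "label_model M G S N U f Y"
    and delta: "\<delta> > 1"
    and unique_kappa: "\<exists>!\<sigma>. 0 \<le> \<sigma> \<and> kappa M G S Y \<sigma> = 1 / \<delta>"
    and l_opt_min_exists:
      "\<And>w. \<exists>v\<^sub>0. \<forall>v. moreau_objective (h_opt M G S Y \<delta>) w 1 v\<^sub>0
                    \<le> moreau_objective (h_opt M G S Y \<delta>) w 1 v"
    and l_opt_convex: "convex_on UNIV (l_opt M G S Y \<delta>)"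
    and unique_system: "\<exists>\<^sub>\<le>\<^sub>1 t. solves_system M G S Y \<delta> (l_opt M G S Y \<delta>) t"
  shows "sigma_loss M G S Y \<delta> (l_opt M G S Y \<delta>) = sigma_opt M G S Y \<delta>"
proof -
  from unique_kappa obtain s where s: "0 \<le> s \<and> kappa M G S Y s = 1 / \<delta>"
    and unique: "\<forall>\<sigma>. 0 \<le> \<sigma> \<and> kappa M G S Y \<sigma> = 1 / \<delta> \<longrightarrow> \<sigma> = s"
    by (rule ex1E)
  have sigma_opt: "sigma_opt M G S Y \<delta> = s"
    unfolding sigma_opt_def using s unique by (intro Least_equality) (blast, metis order_refl)
  have "s \<noteq> 0" using s delta by (auto simp: kappa_def)
  with s have "0 < s" by simp
  then interpret unit_gaussian_smoothing M G "\<lambda>\<omega>. S \<omega> * Y \<omega>" s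
    by (rule label_model_unit_gaussian_smoothing[OF model])
  have W_rv: "W_rv G S Y s = W"
    by (simp add: W_rv_def W_def[abs_def])
  have kappa_eq: "s\<^sup>2 * (s\<^sup>2 * info + info - 1) / (1 + s\<^sup>2 * (s\<^sup>2 * info - 1)) = 1 / \<delta>"
    using s \<open>s \<noteq> 0\<close> by (simp add: kappa_def W_rv Let_def)
  have "0 < \<delta>" using delta by simp
  note coeffs = optimal_coefficients[OF this kappa_eq]
  let ?a = "(1 - s\<^sup>2 * info) / (\<delta> * (s\<^sup>2 * info + info - 1))"
  let ?b = "1 / (\<delta> * (s\<^sup>2 * info + info - 1))"
  let ?h = "\<lambda>x. ?a * (x\<^sup>2 / 2) + ?b * ln (dens x)"
  have h_opt: "h_opt M G S Y \<delta> = ?h"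
    by (rule ext) (simp add: h_opt_def alpha1_def alpha2_def W_opt_def sigma_opt W_rv Let_def diff_density_W)
  then have l_opt: "l_opt M G S Y \<delta> = (\<lambda>w. - moreau_env ?h w 1)"
    by (intro ext) (simp only: l_opt_def)
  have "moreau_deriv (l_opt M G S Y \<delta>) x 1 = - (?a * x + ?b * score x)" for x
    unfolding l_opt
    using l_opt_min_exists[unfolded h_opt] by (rule moreau_deriv_score_loss[OF coeffs(1,2)])
  then have "solves_system M G S Y \<delta> (l_opt M G S Y \<delta>) (1, s, 1)"
    by (rule score_loss_solves_system[OF refl _ coeffs(3-5)])
  then have "(THE t. solves_system M G S Y \<delta> (l_opt M G S Y \<delta>) t) = (1, s, 1)"
    by (rule the1_equality'[OF unique_system])
  then show ?thesis
    by (simp add: sigma_loss_def sigma_opt)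
qed

end
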